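(* Let $G$ be an elementary abelian $2$-group of order $n=2^r$, and let $h$ be an integer with $n/2-1\le h\le n-2$. Then $Z_h(G)=h$ if $h=n-4$, and $Z_h(G)=h+2$ otherwise.
   Context: $G$ is written additively. For $A\subseteq G$ and a positive integer $h$, $h\hat{\;}A$ denotes the set of all sums of $h$ pairwise distinct elements of $A$. $Z_h(G)=\max\{|A| : A\subseteq G,\ 0\notin h\hat{\;}A\}$. *)

theory Defs
  imports "HOL-Algebra.Algebra"
begin

text \<open>
  Abelian groups are rendered by the locale \<^locale>\<open>comm_group\<close>, which is written
  multiplicatively: \<open>\<one>\<close> stands for the element 0 of the additively written group,
  \<open>finprod\<close> for finite sums, and \<open>x [^] p\<close> for the multiple \<open>p x\<close>.
\<close>

definition elementary_abelian_group :: "nat \<Rightarrow> ('a, 'b) monoid_scheme \<Rightarrow> bool" where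
  "elementary_abelian_group p G \<longleftrightarrow>
     comm_group G \<and> (\<forall>x\<in>carrier G. x [^]\<^bsub>G\<^esub> p = \<one>\<^bsub>G\<^esub>)"

definition restricted_sumset :: "('a, 'b) monoid_scheme \<Rightarrow> nat \<Rightarrow> 'a set \<Rightarrow> 'a set" where
  "restricted_sumset G h A =
     {finprod G (\<lambda>x. x) B |B. B \<subseteq> A \<and> finite B \<and> card B = h}"

text \<open>
  Meaningful for finite \<open>G\<close> and \<open>h \<ge> 1\<close>: then the empty set is always admissible and
  the maximum is over a nonempty finite set. For \<open>h = 0\<close> no set is admissible, because the
  empty sum is 0.
\<close>

definition Z_num :: "nat \<Rightarrow> ('a, 'b) monoid_scheme \<Rightarrow> nat" where
  "Z_num h G = Max {card A |A. A \<subseteq> carrier G \<and> \<one>\<^bsub>G\<^esub> \<notin> restricted_sumset G h A}"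

end

theory Submission
  imports Defs
begin

text \<open>
  Since \<open>n\<close> is divisible by 4, the sum of all elements of \<open>G\<close> is 0, so a set and its complement
  have the same sum. A zero-sum set \<open>A\<close> with \<open>h + 2\<close> elements has no zero-sum \<open>h\<close>-subset, because
  its \<open>h\<close>-subsets have the sums \<open>u + v\<close> with \<open>u \<noteq> v\<close> in \<open>A\<close>; one takes for \<open>A\<close> the complement of
  a zero-sum set with \<open>n - h - 2\<close> elements, which exists unless \<open>n - h - 2 = 2\<close>. Conversely, if
  \<open>A\<close> has \<open>h + 3\<close> elements and sum \<open>s\<close>, choose \<open>a \<noteq> s\<close> in \<open>A\<close>: more than half of \<open>G\<close> lies in
  \<open>A - {a}\<close>, which therefore contains a pair \<open>b, b + (s + a)\<close>, and deleting \<open>a\<close> and this pair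
  leaves a zero-sum \<open>h\<close>-subset. In the case \<open>h = n - 4\<close>, a set with \<open>n - 3\<close> elements contains its
  own sum \<open>x + y + z\<close>, where \<open>x, y, z\<close> are the missing elements, and one deletes it.
\<close>

locale finite_boolean_group = comm_group +
  assumes finite_carrier: "finite (carrier G)"
    and square: "x \<in> carrier G \<Longrightarrow> x \<otimes> x = \<one>"
begin

section \<open>Sums over subsets of a group of exponent 2\<close>

abbreviation total :: "'a set \<Rightarrow> 'a" where
  "total B \<equiv> finprod G (\<lambda>x. x) B"

lemma total_closed [simp]: "B \<subseteq> carrier G \<Longrightarrow> total B \<in> carrier G"
  by (rule finprod_closed) auto

lemma finite_subset_carrier: "B \<subseteq> carrier G \<Longrightarrow> finite B"
  using finite_carrier by (rule finite_subset[rotated])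

lemma cancel_left: "x \<in> carrier G \<Longrightarrow> y \<in> carrier G \<Longrightarrow> x \<otimes> (x \<otimes> y) = y"
  by (simp add: m_assoc[symmetric] square)

lemma cancel_right: "x \<in> carrier G \<Longrightarrow> y \<in> carrier G \<Longrightarrow> (y \<otimes> x) \<otimes> x = y"
  by (simp add: m_assoc square)

lemma mult_eq_one_iff:
  assumes "x \<in> carrier G" "y \<in> carrier G"
  shows "x \<otimes> y = \<one> \<longleftrightarrow> x = y"
  using assms by (metis cancel_left square r_one)

lemma mult_eq_self_iff:
  assumes "x \<in> carrier G" "t \<in> carrier G"
  shows "x \<otimes> t = x \<longleftrightarrow> t = \<one>"
  using assms by simp

lemma total_insert:
  "insert x B \<subseteq> carrier G \<Longrightarrow> x \<notin> B \<Longrightarrow> total (insert x B) = x \<otimes> total B"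
  using finite_subset_carrier[of B] by (auto intro!: finprod_insert)

lemma total_Un:
  assumes "A \<subseteq> carrier G" "B \<subseteq> carrier G" "A \<inter> B = {}"
  shows "total (A \<union> B) = total A \<otimes> total B"
  using assms finite_subset_carrier by (intro finprod_Un_disjoint) auto

lemma total_split:
  assumes "A \<subseteq> carrier G" "B \<subseteq> A"
  shows "total A = total (A - B) \<otimes> total B"
proof -
  have "A = (A - B) \<union> B" "A - B \<subseteq> carrier G" "B \<subseteq> carrier G"
    using assms by auto
  then show ?thesis
    using total_Un[of "A - B" B] by (metis Diff_disjoint Int_commute)
qed

text \<open>Every element is its own inverse, so taking away the sum of \<open>B\<close> is the same
  as adding it.\<close>

lemma total_Diff:
  assumes "A \<subseteq> carrier G" "B \<subseteq> A"
  shows "total (A - B) = total A \<otimes> total B"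
proof -
  have "total A = total (A - B) \<otimes> total B"
    using assms by (rule total_split)
  moreover have "A - B \<subseteq> carrier G" "B \<subseteq> carrier G"
    using assms by auto
  ultimately show ?thesis
    by (simp add: cancel_right)
qed

lemma total_pair:
  assumes "u \<in> carrier G" "v \<in> carrier G" "u \<noteq> v"
  shows "total {u, v} = u \<otimes> v"
  using assms by (simp add: total_insert)

section \<open>The sum of all group elements\<close>

text \<open>\<open>S\<close> splits into pairs \<open>{x, x \<otimes> t}\<close>, each of sum
  \<open>t\<close> because the two copies of \<open>x\<close> cancel. The induction removes one pair
  at a time.\<close>

lemma total_translation_invariant:
  assumes "t \<in> carrier G" "t \<noteq> \<one>"
  shows "S \<subseteq> carrier G \<Longrightarrow> (\<And>x. x \<in> S \<Longrightarrow> x \<otimes> t \<in> S) \<Longrightarrow> total S = t [^] (card S div 2)"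
proof (induction "card S" arbitrary: S rule: less_induct)
  case less
  show ?case
  proof (cases "S = {}")
    case False
    then obtain x where x: "x \<in> S" by auto
    have fin: "finite S" using less.prems finite_subset_carrier by auto
    have xc: "x \<in> carrier G" using x less.prems by auto
    have ne: "x \<noteq> x \<otimes> t" using xc assms mult_eq_self_iff by metis
    have sub: "{x, x \<otimes> t} \<subseteq> S" using x less.prems by auto
    let ?T = "S - {x, x \<otimes> t}"
    have card_pair: "card {x, x \<otimes> t} = 2" using ne by simp
    have card_le: "2 \<le> card S" using card_mono[OF fin sub] card_pair by simp
    have card_T: "card ?T = card S - 2"
      using card_Diff_subset[OF _ sub] card_pair by simp
    \<comment> \<open>Translation by \<open>t\<close> swaps the two removed elements, so the
      remaining set is still invariant.\<close>
    have "y \<otimes> t \<in> ?T" if "y \<in> ?T" for y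
    proof -
      have yc: "y \<in> carrier G" using that less.prems by auto
      have "y \<otimes> t \<noteq> x" using that yc assms cancel_right by auto
      moreover have "y \<otimes> t \<noteq> x \<otimes> t" using that yc xc assms by auto
      ultimately show ?thesis using that less.prems by auto
    qed
    then have "total ?T = t [^] (card ?T div 2)"
      using less.hyps[of ?T] less.prems card_T card_le by auto
    moreover have "total {x, x \<otimes> t} = t"
      using total_pair[of x "x \<otimes> t"] xc assms ne by (simp add: cancel_left)
    moreover have "total S = total ?T \<otimes> total {x, x \<otimes> t}"
      using less.prems(1) sub by (rule total_split)
    moreover have "card S div 2 = Suc (card ?T div 2)" using card_T card_le by simp
    ultimately show ?thesis by simp
  qed simp
qed

lemma total_carrier:
  assumes "4 dvd order G"
  shows "total (carrier G) = \<one>"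
proof -
  have "order G \<noteq> 1" using assms by auto
  then obtain t where t: "t \<in> carrier G" "t \<noteq> \<one>"
    using finite_carrier order_one_triv_iff by blast
  obtain k where k: "order G = 4 * k" using assms by auto
  have "total (carrier G) = t [^] (card (carrier G) div 2)"
    using total_translation_invariant[OF t] t by auto
  \<comment> \<open>The number of pairs is \<open>2 * k\<close>; its evenness is what divisibility
    by 4 provides.\<close>
  also have "\<dots> = (t [^] (2::nat)) [^] k"
    using k t by (simp add: order_def nat_pow_pow)
  also have "\<dots> = \<one>"
    using t square by (simp add: numeral_2_eq_2)
  finally show ?thesis .
qed

lemma total_complement:
  assumes "4 dvd order G" "B \<subseteq> carrier G"
  shows "total (carrier G - B) = total B"
  using assms by (simp add: total_Diff total_carrier)

section \<open>Existence of translates and of sets with prescribed sum\<close>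

text \<open>\<open>S\<close> and its translate by \<open>t\<close> cannot cover the group. An
  element \<open>u\<close> outside both works, since translation by \<open>t\<close> is an
  involution.\<close>

lemma ex_translate_avoiding:
  assumes "S \<subseteq> carrier G" "t \<in> carrier G" "2 * card S < order G"
  obtains u where "u \<in> carrier G" "u \<notin> S" "u \<otimes> t \<notin> S"
proof -
  let ?Y = "S \<union> (\<lambda>x. x \<otimes> t) ` S"
  have fin: "finite S" using assms finite_subset_carrier by auto
  have "card ?Y \<le> card S + card S"
    using card_Un_le[of S] card_image_le[OF fin, of "\<lambda>x. x \<otimes> t"] by (meson add_left_mono le_trans)
  then have "\<not> carrier G \<subseteq> ?Y"
    using assms card_mono[of ?Y "carrier G"] fin by (auto simp: order_def)
  then obtain u where u: "u \<in> carrier G" "u \<notin> ?Y" by auto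
  have "u \<otimes> t \<notin> S"
    using u assms cancel_right[of t u] by (metis UnI2 imageI)
  with u that show thesis by auto
qed

text \<open>A set filling more than half of the group has a complement that fills less than half,
  and this complement can be avoided.\<close>

lemma ex_translate_within:
  assumes "S \<subseteq> carrier G" "t \<in> carrier G" "order G < 2 * card S"
  obtains u where "u \<in> S" "u \<otimes> t \<in> S"
proof -
  have "card (carrier G - S) = order G - card S"
    using assms finite_subset_carrier by (simp add: card_Diff_subset order_def)
  moreover have "card S \<le> order G"
    using assms finite_carrier by (simp add: card_mono order_def)
  ultimately have "2 * card (carrier G - S) < order G"
    using assms by simp
  from ex_translate_avoiding[OF Diff_subset assms(2) this]
  obtain u where "u \<in> carrier G" "u \<notin> carrier G - S" "u \<otimes> t \<notin> carrier G - S" by blast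
  with assms that[of u] show thesis by auto
qed

text \<open>After \<open>k - 1\<close> elements \<open>U\<close> are chosen freely, the last one
  only has to avoid \<open>U\<close> and \<open>total U\<close>, at most \<open>k\<close>
  elements.\<close>

lemma ex_total_not_one:
  assumes "1 \<le> k" "k < order G"
  obtains T where "T \<subseteq> carrier G" "card T = k" "total T \<noteq> \<one>"
proof -
  have "k - 1 \<le> card (carrier G)" using assms by (simp add: order_def)
  then obtain U where U: "U \<subseteq> carrier G" "card U = k - 1"
    by (rule obtain_subset_with_card_n)
  have finU: "finite U" using U finite_subset_carrier by auto
  have "card (insert (total U) U) \<le> k"
    using U assms card_insert_le_m1[of k U "total U"] by simp
  then have "\<not> carrier G \<subseteq> insert (total U) U"
    using card_mono[of "insert (total U) U" "carrier G"] finU assms by (auto simp: order_def)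
  then obtain v where v: "v \<in> carrier G" "v \<noteq> total U" "v \<notin> U" by auto
  show thesis
  proof (rule that)
    show "insert v U \<subseteq> carrier G" using U v by auto
    show "card (insert v U) = k" using U v finU assms by simp
    show "total (insert v U) \<noteq> \<one>"
      using U v by (simp add: total_insert mult_eq_one_iff)
  qed
qed

text \<open>Two distinct elements never sum to 0, hence \<open>k \<noteq> 2\<close>. For
  \<open>k \<ge> 3\<close>, a set of \<open>k - 2\<close> elements with sum
  \<open>t \<noteq> \<one>\<close> is completed by a pair \<open>u\<close>,
  \<open>u \<otimes> t\<close>: its members differ as \<open>t \<noteq> \<one>\<close>, and its sum
  \<open>t\<close> cancels that of the set.\<close>

lemma ex_total_one:
  assumes "k \<noteq> 2" "2 * k < order G"
  obtains K where "K \<subseteq> carrier G" "card K = k" "total K = \<one>"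
proof -
  consider "k = 0" | "k = 1" | "k \<ge> 3" using assms by linarith
  then show thesis
  proof cases
    case 1
    then show ?thesis using that[of "{}"] by simp
  next
    case 2
    then show ?thesis using that[of "{\<one>}"] by (simp add: total_insert)
  next
    case 3
    then have "1 \<le> k - 2" "k - 2 < order G" using assms by auto
    then obtain T where T: "T \<subseteq> carrier G" "card T = k - 2" "total T \<noteq> \<one>"
      by (rule ex_total_not_one)
    have "2 * card T < order G" using T assms by simp
    then obtain u where u: "u \<in> carrier G" "u \<notin> T" "u \<otimes> total T \<notin> T"
      using ex_translate_avoiding[of T "total T"] T by auto
    let ?v = "u \<otimes> total T"
    have v: "?v \<in> carrier G" "u \<noteq> ?v"
      using u T mult_eq_self_iff[of u "total T"] by auto
    have fin: "finite T" using T finite_subset_carrier by auto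
    show ?thesis
    proof (rule that)
      show "insert u (insert ?v T) \<subseteq> carrier G" using u v T by auto
      show "card (insert u (insert ?v T)) = k" using u v T fin 3 by simp
      show "total (insert u (insert ?v T)) = \<one>"
        using u v T by (simp add: total_insert m_assoc cancel_left square)
    qed
  qed
qed

section \<open>Reduction of \<open>Z_num\<close> to two consecutive cardinalities\<close>

lemma one_in_restricted_sumset_iff:
  assumes "A \<subseteq> carrier G"
  shows "\<one> \<in> restricted_sumset G h A \<longleftrightarrow> (\<exists>B\<subseteq>A. card B = h \<and> total B = \<one>)"
  using finite_subset_carrier[OF order_trans[OF _ assms]] unfolding restricted_sumset_def
  by (simp add: eq_commute[of \<one>]) blast

text \<open>Admissibility passes to subsets, so any larger admissible set would contain one with
  exactly \<open>Suc m\<close> elements.\<close>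

lemma Z_num_eqI:
  assumes "A \<subseteq> carrier G" "card A = m" "\<And>B. B \<subseteq> A \<Longrightarrow> card B = h \<Longrightarrow> total B \<noteq> \<one>"
    and "\<And>A. A \<subseteq> carrier G \<Longrightarrow> card A = Suc m \<Longrightarrow> \<exists>B\<subseteq>A. card B = h \<and> total B = \<one>"
  shows "Z_num h G = m"
  unfolding Z_num_def
proof (rule Max_eqI)
  show "finite {card A |A. A \<subseteq> carrier G \<and> \<one> \<notin> restricted_sumset G h A}"
    using finite_carrier by simp
  show "m \<in> {card A |A. A \<subseteq> carrier G \<and> \<one> \<notin> restricted_sumset G h A}"
    using assms(1-3) one_in_restricted_sumset_iff by blast
  fix y assume "y \<in> {card A |A. A \<subseteq> carrier G \<and> \<one> \<notin> restricted_sumset G h A}"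
  then obtain C where C: "y = card C" "C \<subseteq> carrier G" "\<one> \<notin> restricted_sumset G h C"
    by auto
  show "y \<le> m"
  proof (rule ccontr)
    assume "\<not> y \<le> m"
    then obtain D where "D \<subseteq> C" "card D = Suc m"
      using obtain_subset_with_card_n[of "Suc m" C] C(1) by (metis not_less_eq_eq)
    then show False
      using assms(4)[of D] C one_in_restricted_sumset_iff[of C h] by (meson order_trans)
  qed
qed

section \<open>Deleting two, three or one elements from a set\<close>

lemma total_card_minus_2_not_one:
  assumes "A \<subseteq> carrier G" "total A = \<one>" "B \<subseteq> A" "card A = card B + 2"
  shows "total B \<noteq> \<one>"
proof -
  have "card (A - B) = 2"
    using assms finite_subset_carrier by (simp add: card_Diff_subset finite_subset)
  then obtain u v where uv: "A - B = {u, v}" "u \<noteq> v" by (auto simp: card_2_iff)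
  have "B = A - (A - B)" using assms by auto
  moreover have carr: "u \<in> carrier G" "v \<in> carrier G" using uv assms by auto
  ultimately have "total B = total {u, v}"
    using total_Diff[of A "{u, v}"] assms uv by (metis Diff_subset l_one total_closed order_trans)
  then show ?thesis
    using uv carr by (simp add: total_pair mult_eq_one_iff)
qed

lemma ex_total_one_subset_minus_3:
  assumes "A \<subseteq> carrier G" "card A = h + 3" "order G < 2 * (h + 2)"
  shows "\<exists>B\<subseteq>A. card B = h \<and> total B = \<one>"
proof -
  have fin: "finite A" using assms finite_subset_carrier by auto
  have "\<not> A \<subseteq> {total A}"
    using card_mono[of "{total A}" A] assms by auto
  then obtain a where a: "a \<in> A" "a \<noteq> total A" by auto
  have carr: "a \<in> carrier G" "total A \<in> carrier G" using a assms by auto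
  let ?t = "total A \<otimes> a"
  \<comment> \<open>\<open>A - {a}\<close> has \<open>h + 2\<close> elements, still more than half
    of the group.\<close>
  have "order G < 2 * card (A - {a})" using a assms fin by simp
  then obtain b where b: "b \<in> A - {a}" "b \<otimes> ?t \<in> A - {a}"
    using ex_translate_within[of "A - {a}" ?t] carr assms by auto
  let ?c = "b \<otimes> ?t"
  have bc: "b \<in> carrier G" using b assms by auto
  \<comment> \<open>The shift \<open>?t\<close> is nontrivial exactly because \<open>a\<close> was
    chosen different from \<open>total A\<close>.\<close>
  have ne: "b \<noteq> ?c"
    using mult_eq_self_iff[of b ?t] mult_eq_one_iff[of "total A" a] carr bc a by auto
  let ?D = "{a, b, ?c}"
  have sub: "?D \<subseteq> A" using a b by auto
  have "total ?D = a \<otimes> (b \<otimes> ?c)"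
    using a b ne bc carr total_insert[of a "{b, ?c}"] total_pair[of b ?c] by auto
  also have "\<dots> = total A"
    using bc carr by (simp add: cancel_left m_comm[of "total A"])
  finally have "total (A - ?D) = \<one>"
    using total_Diff[OF assms(1) sub] carr by (simp add: square)
  moreover have "card (A - ?D) = h"
  proof -
    have "card ?D = 3" using a b ne by auto
    then show ?thesis using card_Diff_subset[OF _ sub] assms by simp
  qed
  ultimately show ?thesis by blast
qed

lemma ex_total_one_subset_minus_1:
  assumes "4 dvd order G" "A \<subseteq> carrier G" "card A + 3 = order G"
  shows "\<exists>B\<subseteq>A. card B + 1 = card A \<and> total B = \<one>"
proof -
  have fin: "finite A" using assms finite_subset_carrier by auto
  have "card (carrier G - A) = 3"
    using assms fin by (simp add: card_Diff_subset order_def)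
  then obtain x y z where xyz: "carrier G - A = {x, y, z}" "x \<noteq> y" "x \<noteq> z" "y \<noteq> z"
    by (auto simp: card_3_iff)
  have carr: "x \<in> carrier G" "y \<in> carrier G" "z \<in> carrier G" using xyz by auto
  have "total A = total (carrier G - A)"
    using total_complement assms by simp
  then have tot: "total A = x \<otimes> (y \<otimes> z)"
    using xyz carr by (simp add: total_insert)
  \<comment> \<open>Equality would force \<open>y = z\<close>; the other two missing elements are
    excluded likewise.\<close>
  have "x \<otimes> (y \<otimes> z) \<noteq> x"
    using xyz carr mult_eq_self_iff[of x "y \<otimes> z"] by (simp add: mult_eq_one_iff)
  moreover have "x \<otimes> (y \<otimes> z) \<noteq> y"
    using xyz carr mult_eq_self_iff[of y "x \<otimes> z"] by (simp add: mult_eq_one_iff m_lcomm[of x y z])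
  moreover have "x \<otimes> (y \<otimes> z) \<noteq> z"
    using xyz carr mult_eq_self_iff[of z "x \<otimes> y"]
    by (simp add: mult_eq_one_iff m_assoc[symmetric] m_comm[of z])
  ultimately have "total A \<notin> carrier G - A" using xyz tot by auto
  then have mem: "total A \<in> A" using assms by auto
  then have "total (A - {total A}) = \<one>"
    using total_Diff[of A "{total A}"] assms by (auto simp: total_insert square)
  moreover have "card (A - {total A}) + 1 = card A"
    using mem fin by (metis Suc_eq_plus1 card.remove)
  ultimately show ?thesis by blast
qed

end

theorem theorem4p5:
  fixes G :: "('a, 'b) monoid_scheme" and n r h :: nat
  assumes "elementary_abelian_group 2 G"
    and "order G = n" and "n = 2 ^ r"
    and "h \<ge> 1"
    and "real n / 2 - 1 \<le> real h" and "int h \<le> int n - 2"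
  shows "Z_num h G = (if int h = int n - 4 then h else h + 2)"
proof -
  have G: "comm_group G" "\<forall>x\<in>carrier G. x [^]\<^bsub>G\<^esub> (2::nat) = \<one>\<^bsub>G\<^esub>"
    using assms(1) by (auto simp: elementary_abelian_group_def)
  interpret comm_group G by fact
  have h: "n \<le> 2 * h + 2" "h + 2 \<le> n" using assms(5,6) by linarith+
  \<comment> \<open>An infinite carrier would have order 0 by convention, but \<open>n\<close> is
    positive.\<close>
  have fin: "finite (carrier G)"
    using assms h by (intro card_ge_0_finite) (simp add: order_def)
  interpret finite_boolean_group G
    using fin G(2) by unfold_locales (auto simp: numeral_2_eq_2)
  \<comment> \<open>From \<open>h \<ge> 1\<close> and \<open>h + 2 \<le> n\<close> follows
    \<open>n \<ge> 3\<close>, which rules out the orders 1 and 2.\<close>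
  have "r \<ge> 2"
  proof (rule ccontr)
    assume "\<not> r \<ge> 2"
    then have "r = 0 \<or> r = 1" by auto
    then show False using assms(3,4) h by auto
  qed
  then have dvd4: "4 dvd order G"
    using assms(2,3) le_imp_power_dvd[of 2 r "2::nat"] by simp
  show ?thesis
  proof (cases "h + 4 = n")
    case True
    \<comment> \<open>The only \<open>h\<close>-subset of an \<open>h\<close>-set is the set itself,
      so a nonzero sum suffices for the lower bound.\<close>
    obtain T where T: "T \<subseteq> carrier G" "card T = h" "total T \<noteq> \<one>\<^bsub>G\<^esub>"
      using ex_total_not_one[of h] assms True by auto
    have "Z_num h G = h"
    proof (rule Z_num_eqI[OF T(1,2)])
      show "total B \<noteq> \<one>\<^bsub>G\<^esub>" if "B \<subseteq> T" "card B = h" for B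
        using that T card_subset_eq[of T B] finite_subset_carrier by auto
      show "\<exists>B\<subseteq>A. card B = h \<and> total B = \<one>\<^bsub>G\<^esub>" if "A \<subseteq> carrier G" "card A = Suc h" for A
        using ex_total_one_subset_minus_1[OF dvd4 that(1)] that(2) True assms(2) by auto
    qed
    then show ?thesis using True by auto
  next
    case False
    have "n - (h + 2) \<noteq> 2" using False h by arith
    \<comment> \<open>Here the lower bound on \<open>h\<close> enters:
      \<open>n \<le> 2 * h + 2\<close> keeps the complement below half of the group.\<close>
    moreover have "2 * (n - (h + 2)) < order G" unfolding assms(2) using h by arith
    ultimately obtain K where K: "K \<subseteq> carrier G" "card K = n - (h + 2)" "total K = \<one>\<^bsub>G\<^esub>"
      by (rule ex_total_one)
    let ?A = "carrier G - K"
    have A: "?A \<subseteq> carrier G" "total ?A = \<one>\<^bsub>G\<^esub>"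
      using K total_complement[OF dvd4] by auto
    have card_A: "card ?A = h + 2"
      using K assms(2) h finite_subset_carrier by (simp add: card_Diff_subset order_def)
    have "Z_num h G = h + 2"
    proof (rule Z_num_eqI[OF A(1) card_A])
      show "total B \<noteq> \<one>\<^bsub>G\<^esub>" if "B \<subseteq> ?A" "card B = h" for B
        using total_card_minus_2_not_one[OF A that(1)] card_A that(2) by simp
      show "\<exists>B\<subseteq>A. card B = h \<and> total B = \<one>\<^bsub>G\<^esub>" if "A \<subseteq> carrier G" "card A = Suc (h + 2)" for A
        using ex_total_one_subset_minus_3[of A h] that h assms(2) by simp
    qed
    then show ?thesis using False by auto
  qed
qed

end
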